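(* The hypersequent calculus for $\mathrm{STL}_\infty$ (without negation) described below is sound: for every hypersequent $\Gamma_1\vdash\Delta_1\mid\cdots\mid\Gamma_k\vdash\Delta_k$ derivable in it, there exists $j$ such that the sequent $\Gamma_j\vdash\Delta_j$ is sound.
   Context: Formulas are built from atomic formulas $r_1\le r_2$, $r_1=r_2$ ($r_1,r_2$ real numbers) and constants $\top,\bot$ using binary connectives $\wedge,\vee,\odot,\oplus,\Rightarrow$ (no negation). Interpretation into extended reals $[-\infty,+\infty]$: $\llbracket r_1\le r_2\rrbracket=r_2-r_1$, $\llbracket r_1=r_2\rrbracket=-|r_2-r_1|$, $\llbracket\top\rrbracket=+\infty$, $\llbracket\bot\rrbracket=-\infty$, $\wedge,\odot$ interpreted as $\min$, $\vee,\oplus$ as $\max$, $\llbracket p\Rightarrow q\rrbracket=+\infty$ if $\llbracket p\rrbracket\le\llbracket q\rrbracket$ and $=\llbracket q\rrbracket$ otherwise. A sequent $\Gamma\vdash\Delta$ is a pair of finite lists of formulas; a hypersequent is a finite list of sequents separated by $\mid$. A sequent $q_1,\dots,q_n\vdash p_1,\dots,p_m$ is sound if $\min_i\llbracket q_i\rrbracket\le\max_j\llbracket p_j\rrbracket$, where the empty minimum is $+\infty$ and the empty maximum is $-\infty$. Rules ($H,G$ hypersequents, possibly empty; $\Gamma,\Sigma,\Delta,\Pi$ lists of formulas; premises / conclusion): axioms $H\mid p\vdash p$; $H\mid\Gamma,\bot\vdash\Delta$; $H\mid\Gamma\vdash\top$. EW: $H$ / $H\mid G$. EC: $H\mid G\mid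 G$ / $H\mid G$. EE: $H_1\mid G_1\mid G_2\mid H_2$ / $H_1\mid G_2\mid G_1\mid H_2$. COM: $H\mid\Gamma_1,\Sigma_1\vdash\Delta$ and $H\mid\Gamma_2,\Sigma_2\vdash\Pi$ / $H\mid\Gamma_1,\Gamma_2\vdash\Delta\mid\Sigma_1,\Sigma_2\vdash\Pi$. W: $H\mid\Gamma\vdash\Delta$ / $H\mid\Gamma,\Sigma\vdash\Delta$. C: $H\mid\Gamma,\Sigma,\Sigma\vdash\Delta$ / $H\mid\Gamma,\Sigma\vdash\Delta$. Left/right exchange of two adjacent formulas. (L$\wedge$): $H\mid\Gamma,p_0\vdash\Delta\mid\Gamma,p_1\vdash\Delta$ / $H\mid\Gamma,p_0\wedge p_1\vdash\Delta$. (R$\wedge$): $H\mid\Gamma\vdash p_0$ and $H\mid\Gamma\vdash p_1$ / $H\mid\Gamma\vdash p_0\wedge p_1$. (L$\vee$): $H\mid\Gamma,p_0\vdash\Delta$ and $H\mid\Gamma,p_1\vdash\Delta$ / $H\mid\Gamma,p_0\vee p_1\vdash\Delta$. (R$\vee$): $H\mid\Gamma\vdash p_0\mid\Gamma\vdash p_1$ / $H\mid\Gamma\vdash p_0\vee p_1$. (L$\Rightarrow$): $H\mid\Gamma\vdash p_0$ and $H\mid\Gamma,p_1\vdash\Delta$ / $H\mid\Gamma,p_0\Rightarrow p_1\vdash\Delta$. (R$\Rightarrow$): $H\mid\Gamma,p_0\vdash p_1$ / $H\mid\Gamma\vdash p_0\Rightarrow p_1$. Derivable hypersequents are those obtained by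 finitely many rule applications. *)

theory Defs
  imports "HOL-Library.Extended_Real"
begin

datatype formula =
    Leq real real
  | Eq real real
  | Top
  | Bot
  | Conj formula formula
  | Disj formula formula
  | ODot formula formula
  | OPlus formula formula
  | Imp formula formula

primrec sem :: "formula \<Rightarrow> ereal" where
  "sem (Leq r1 r2) = ereal (r2 - r1)"
| "sem (Eq r1 r2) = ereal (- \<bar>r2 - r1\<bar>)"
| "sem Top = \<infinity>"
| "sem Bot = - \<infinity>"
| "sem (Conj p q) = min (sem p) (sem q)"
| "sem (Disj p q) = max (sem p) (sem q)"
| "sem (ODot p q) = min (sem p) (sem q)"
| "sem (OPlus p q) = max (sem p) (sem q)"
| "sem (Imp p q) = (if sem p \<le> sem q then \<infinity> else sem q)"

type_synonym sequent = "formula list \<times> formula list"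
type_synonym hypersequent = "sequent list"

abbreviation sequent_of :: "formula list \<Rightarrow> formula list \<Rightarrow> sequent" (infix "\<turnstile>" 60) where
  "\<Gamma> \<turnstile> \<Delta> \<equiv> (\<Gamma>, \<Delta>)"

definition min_sem :: "formula list \<Rightarrow> ereal" where
  "min_sem \<Gamma> = foldr min (map sem \<Gamma>) \<infinity>"

definition max_sem :: "formula list \<Rightarrow> ereal" where
  "max_sem \<Delta> = foldr max (map sem \<Delta>) (- \<infinity>)"

definition sound_sequent :: "sequent \<Rightarrow> bool" where
  "sound_sequent S \<longleftrightarrow> min_sem (fst S) \<le> max_sem (snd S)"

text \<open>
  List concatenation renders both the comma and the bar. The connectives \<^const>\<open>ODot\<close> and
  \<^const>\<open>OPlus\<close> belong to the language but have no logical rules of their own.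
\<close>

inductive derivable :: "hypersequent \<Rightarrow> bool" where
  Ax: "derivable (H @ [[p] \<turnstile> [p]])"
| AxBot: "derivable (H @ [\<Gamma> @ [Bot] \<turnstile> \<Delta>])"
| AxTop: "derivable (H @ [\<Gamma> \<turnstile> [Top]])"
| EW: "derivable H \<Longrightarrow> derivable (H @ G)"
| EC: "derivable (H @ G @ G) \<Longrightarrow> derivable (H @ G)"
| EE: "derivable (H1 @ G1 @ G2 @ H2) \<Longrightarrow> derivable (H1 @ G2 @ G1 @ H2)"
| COM: "derivable (H @ [\<Gamma>1 @ \<Sigma>1 \<turnstile> \<Delta>]) \<Longrightarrow> derivable (H @ [\<Gamma>2 @ \<Sigma>2 \<turnstile> \<Pi>])
    \<Longrightarrow> derivable (H @ [\<Gamma>1 @ \<Gamma>2 \<turnstile> \<Delta>, \<Sigma>1 @ \<Sigma>2 \<turnstile> \<Pi>])"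
| W: "derivable (H @ [\<Gamma> \<turnstile> \<Delta>]) \<Longrightarrow> derivable (H @ [\<Gamma> @ \<Sigma> \<turnstile> \<Delta>])"
| C: "derivable (H @ [\<Gamma> @ \<Sigma> @ \<Sigma> \<turnstile> \<Delta>]) \<Longrightarrow> derivable (H @ [\<Gamma> @ \<Sigma> \<turnstile> \<Delta>])"
| LE: "derivable (H @ [\<Gamma> @ [p, q] @ \<Sigma> \<turnstile> \<Delta>]) \<Longrightarrow> derivable (H @ [\<Gamma> @ [q, p] @ \<Sigma> \<turnstile> \<Delta>])"
| RE: "derivable (H @ [\<Gamma> \<turnstile> \<Delta> @ [p, q] @ \<Pi>]) \<Longrightarrow> derivable (H @ [\<Gamma> \<turnstile> \<Delta> @ [q, p] @ \<Pi>])"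
| LConj: "derivable (H @ [\<Gamma> @ [p0] \<turnstile> \<Delta>, \<Gamma> @ [p1] \<turnstile> \<Delta>])
    \<Longrightarrow> derivable (H @ [\<Gamma> @ [Conj p0 p1] \<turnstile> \<Delta>])"
| RConj: "derivable (H @ [\<Gamma> \<turnstile> [p0]]) \<Longrightarrow> derivable (H @ [\<Gamma> \<turnstile> [p1]])
    \<Longrightarrow> derivable (H @ [\<Gamma> \<turnstile> [Conj p0 p1]])"
| LDisj: "derivable (H @ [\<Gamma> @ [p0] \<turnstile> \<Delta>]) \<Longrightarrow> derivable (H @ [\<Gamma> @ [p1] \<turnstile> \<Delta>])
    \<Longrightarrow> derivable (H @ [\<Gamma> @ [Disj p0 p1] \<turnstile> \<Delta>])"
| RDisj: "derivable (H @ [\<Gamma> \<turnstile> [p0], \<Gamma> \<turnstile> [p1]])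
    \<Longrightarrow> derivable (H @ [\<Gamma> \<turnstile> [Disj p0 p1]])"
| LImp: "derivable (H @ [\<Gamma> \<turnstile> [p0]]) \<Longrightarrow> derivable (H @ [\<Gamma> @ [p1] \<turnstile> \<Delta>])
    \<Longrightarrow> derivable (H @ [\<Gamma> @ [Imp p0 p1] \<turnstile> \<Delta>])"
| RImp: "derivable (H @ [\<Gamma> @ [p0] \<turnstile> [p1]]) \<Longrightarrow> derivable (H @ [\<Gamma> \<turnstile> [Imp p0 p1]])"

end

theory Submission imports Defs begin

lemma min_sem_simps [simp]:
  "min_sem [] = \<infinity>"
  "min_sem (p # \<Gamma>) = min (sem p) (min_sem \<Gamma>)"
  by (simp_all add: min_sem_def)

lemma min_sem_append [simp]: "min_sem (\<Gamma> @ \<Sigma>) = min (min_sem \<Gamma>) (min_sem \<Sigma>)"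
  by (induction \<Gamma>) (simp_all add: min.assoc)

lemma max_sem_simps [simp]:
  "max_sem [] = - \<infinity>"
  "max_sem (p # \<Delta>) = max (sem p) (max_sem \<Delta>)"
  by (simp_all add: max_sem_def)

lemma max_sem_append [simp]: "max_sem (\<Delta> @ \<Pi>) = max (max_sem \<Delta>) (max_sem \<Pi>)"
  by (induction \<Delta>) (simp_all add: max.assoc)

lemma sound_sequent_iff [simp]: "sound_sequent (\<Gamma> \<turnstile> \<Delta>) \<longleftrightarrow> min_sem \<Gamma> \<le> max_sem \<Delta>"
  by (simp add: sound_sequent_def)

text \<open>
  If both conclusions failed, each premise would hold only through the half of its antecedent that
  moves to the other sequent, and then \<open>s1 \<le> d < g2 \<le> e < s1\<close>.
\<close>
lemma min_le_communication:
  fixes d e g1 g2 s1 s2 :: "'a :: linorder"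
  assumes "min g1 s1 \<le> d" and "min g2 s2 \<le> e"
  shows "min g1 g2 \<le> d \<or> min s1 s2 \<le> e"
  using assms by (auto simp: min_le_iff_disj)

text \<open>Membership in \<open>set\<close> replaces an index: concatenation becomes union, so
  order and repetition of components no longer matter, which settles \<open>EW\<close>,
  \<open>EC\<close> and \<open>EE\<close>.\<close>

lemma derivable_imp_sound: "derivable \<H> \<Longrightarrow> \<exists>S \<in> set \<H>. sound_sequent S"
proof (induction rule: derivable.induct)
  case (COM H \<Gamma>1 \<Sigma>1 \<Delta> \<Gamma>2 \<Sigma>2 \<Pi>)
  then show ?case
    using min_le_communication[of "min_sem \<Gamma>1" "min_sem \<Sigma>1" "max_sem \<Delta>"
        "min_sem \<Gamma>2" "min_sem \<Sigma>2" "max_sem \<Pi>"]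
    by auto
\<comment> \<open>In \<open>LImp\<close>, if \<open>sem p0\<close> \<le> \<open>sem p1\<close>, the
  first premise bounds \<open>min_sem \<Gamma>\<close> by \<open>sem p1\<close>, so the second gives
  \<open>min_sem \<Gamma>\<close> \<le> \<open>max_sem \<Delta>\<close>; otherwise the implication
  has the value of \<open>p1\<close>.\<close>
qed (auto simp: min_le_iff_disj le_max_iff_disj)

theorem theorem6:
  fixes \<H> :: hypersequent
  assumes "derivable \<H>"
  shows "\<exists>j < length \<H>. sound_sequent (\<H> ! j)"
  using derivable_imp_sound[OF assms] by (metis in_set_conv_nth)

end
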